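(* Let $E$ be a finite directed graph with a root and without circuits. $E$ is the proper communication graph of the left Krieger cover of an AFT shift if there is an edge from $u\in E^0$ to $v\in E^0$ whenever $u>v$.
   Context: Graphs. A directed graph is $E=(E^0,E^1,r,s)$, edge $e$ going from $s(e)$ to $r(e)$. A circuit is a path of positive length with equal source and range. $u\geq v$ means there is a path (possibly of length $0$) from $u$ to $v$, and $u>v$ means $u\ge v$ but not $v\geq u$. A vertex is maximal if it is connected by a path to all other vertices; if $E$ has a unique maximal vertex, this vertex is the root of $E$. Vertices $u,v$ properly communicate if there are paths of length at least $1$ from $u$ to $v$ and from $v$ to $u$. The proper communication sets of vertices are the maximal disjoint subsets of $E^0$ such that $u,v$ properly communicate if and only if they belong to the same subset (vertices lying on no circuit belong to none of them). The proper communication graph $PC(E)$ is the directed graph whose vertices are the proper communication sets, and in which there is an edge from one proper communication set to another if and only if there is a path from a vertex in the first set to a vertex in the second. The proper communication graph of a labelled graph is that of its underlying directed graph. Shifts. A shift space is a closed subset $X\subseteq\mathcal{A}^{\mathbb{Z}}$ ($\mathcal{A}$ a finite discrete alphabet, product topology) invariant under the shift $\sigma(x)_i=x_{i+1}$. It is a shift of finite type if it is the set of bi-infinite sequences avoiding some finite set of forbidden words, and sofic if it is the image of a shift of finite type under a continuous shift-commuting map. It is irreducible if for all words $u,w$ in the language $\mathcal{B}(X)$ (finite words occurring in elements of $X$) there is $v\in\mathcal{B}(X)$ with $uvw\in\mathcal{B}(X)$. A labelled graph $(E,\mathcal{L})$ (a directed graph with a labelling $\mathcal{L}\colon E^1\to\mathcal{A}$)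 presents $X$ if $X$ is the set of label sequences of bi-infinite paths in $E$; it is left-resolving if no vertex receives two edges with the same label. The left Fischer cover of an irreducible sofic shift $X$ is its left-resolving presentation with the fewest vertices among left-resolving presentations (unique up to labelled graph isomorphism). An irreducible sofic shift has almost finite type (is an AFT shift) if its left Fischer cover is right-closing, i.e. there is $D\geq 0$ such that any two paths of length $D+1$ with the same source and the same label have the same first edge. With $X^+=\{x_0x_1\cdots : x\in X\}$, $X^-=\{\cdots x_{-2}x_{-1} : x\in X\}$ and $P_\infty(x^+)=\{y^-\in X^- : y^-x^+\in X\}$ for $x^+\in X^+$, the left Krieger cover of $X$ is the labelled graph with vertex set $\{P_\infty(x^+) : x^+\in X^+\}$ which has an edge labelled $a\in\mathcal{A}$ from $P$ to $P'$ if and only if there is $x^+\in X^+$ with $ax^+\in X^+$, $P=P_\infty(ax^+)$ and $P'=P_\infty(x^+)$. *)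

theory Defs
  imports "HOL-Analysis.Function_Topology" "Graph_Theory.Graph_Theory"
begin

section \<open>Directed graphs\<close>

text \<open>
  Directed graphs \<open>E = (E\<^sup>0, E\<^sup>1, r, s)\<close> are values of type \<open>pre_digraph\<close> satisfying
  \<open>wf_digraph\<close>, with \<open>s\<close> rendered as \<open>tail\<close> and \<open>r\<close> as \<open>head\<close>; loops and parallel arcs are allowed.
  The relation \<open>u \<ge> v\<close> is \<open>u \<rightarrow>\<^sup>* v\<close>, and circuits, unlike the
  library's \<open>cycle\<close>, may repeat vertices.
\<close>

definition strictly_above :: "('v,'e) pre_digraph \<Rightarrow> 'v \<Rightarrow> 'v \<Rightarrow> bool" where
  "strictly_above G u v \<longleftrightarrow> u \<rightarrow>\<^sup>*\<^bsub>G\<^esub> v \<and> \<not> v \<rightarrow>\<^sup>*\<^bsub>G\<^esub> u"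

definition maximal_vertex :: "('v,'e) pre_digraph \<Rightarrow> 'v \<Rightarrow> bool" where
  "maximal_vertex G u \<longleftrightarrow> u \<in> verts G \<and> (\<forall>v\<in>verts G. u \<rightarrow>\<^sup>*\<^bsub>G\<^esub> v)"

definition has_root :: "('v,'e) pre_digraph \<Rightarrow> bool" where
  "has_root G \<longleftrightarrow> (\<exists>!u. maximal_vertex G u)"

definition has_circuit :: "('v,'e) pre_digraph \<Rightarrow> bool" where
  "has_circuit G \<longleftrightarrow> (\<exists>u p. p \<noteq> [] \<and> pre_digraph.awalk G u p u)"

definition properly_communicate :: "('v,'e) pre_digraph \<Rightarrow> 'v \<Rightarrow> 'v \<Rightarrow> bool" where
  "properly_communicate G u v \<longleftrightarrow> u \<rightarrow>\<^sup>+\<^bsub>G\<^esub> v \<and> v \<rightarrow>\<^sup>+\<^bsub>G\<^esub> u"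

text \<open>
  Proper communication is symmetric and transitive, and reflexive exactly at the vertices
  lying on a circuit; the proper communication sets are its equivalence classes there
  (see \<open>proper_communication_sets_unique\<close> for the characterization by disjoint sets).
\<close>

definition proper_communication_sets :: "('v,'e) pre_digraph \<Rightarrow> 'v set set" where
  "proper_communication_sets G =
     {u \<in> verts G. properly_communicate G u u} // {(u, v). properly_communicate G u v}"

lemma proper_communication_sets_iff:
  "S \<in> proper_communication_sets G \<longleftrightarrow>
    (\<exists>u\<in>verts G. properly_communicate G u u \<and> S = {v. properly_communicate G u v})"
  by (auto simp: proper_communication_sets_def quotient_def)

lemma properly_communicate_sym:
  "properly_communicate G u v \<Longrightarrow> properly_communicate G v u"
  by (auto simp: properly_communicate_def)

lemma properly_communicate_trans:
  "properly_communicate G u v \<Longrightarrow> properly_communicate G v w \<Longrightarrow> properly_communicate G u w"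
  by (auto simp: properly_communicate_def intro: trancl_trans)

lemma proper_communication_sets_unique:
  assumes "wf_digraph G"
  shows "P = proper_communication_sets G \<longleftrightarrow>
    {} \<notin> P \<and> disjoint P \<and> \<Union> P \<subseteq> verts G \<and>
    (\<forall>u\<in>verts G. \<forall>v\<in>verts G. properly_communicate G u v \<longleftrightarrow> (\<exists>S\<in>P. u \<in> S \<and> v \<in> S))"
    (is "_ \<longleftrightarrow> ?R P")
proof -
  have inV: "u \<in> verts G" "v \<in> verts G" if "properly_communicate G u v" for u v
    using that wf_digraph.reachable1_in_verts[OF assms] by (auto simp: properly_communicate_def)
  note sym = properly_communicate_sym[of G] and trans = properly_communicate_trans[of G]
  have refl: "properly_communicate G u u" if "properly_communicate G u v" for u v
    using that by (meson sym trans)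
  have 1: "?R (proper_communication_sets G)"
    unfolding disjoint_def Union_eq
  proof (intro conjI ballI impI)
    show "{} \<notin> proper_communication_sets G"
      by (auto simp: proper_communication_sets_iff)
    show "S \<inter> T = {}" if S: "S \<in> proper_communication_sets G"
      and T: "T \<in> proper_communication_sets G" and "S \<noteq> T" for S T
    proof (rule ccontr)
      assume "S \<inter> T \<noteq> {}"
      then obtain x where x: "x \<in> S" "x \<in> T" by blast
      obtain u where u: "S = {v. properly_communicate G u v}"
        using S by (auto simp: proper_communication_sets_iff)
      obtain w where w: "T = {v. properly_communicate G w v}"
        using T by (auto simp: proper_communication_sets_iff)
      have "properly_communicate G u x" "properly_communicate G w x"
        using x u w by simp_all
      then have "properly_communicate G u w" "properly_communicate G w u"
        by (meson sym trans)+
      then have "properly_communicate G u v \<longleftrightarrow> properly_communicate G w v" for v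
        by (meson trans)
      then have "S = T" using u w by simp
      with \<open>S \<noteq> T\<close> show False ..
    qed
    show "{x. \<exists>S\<in>proper_communication_sets G. x \<in> S} \<subseteq> verts G"
      using inV by (auto simp: proper_communication_sets_iff)
    show "properly_communicate G u v \<longleftrightarrow> (\<exists>S\<in>proper_communication_sets G. u \<in> S \<and> v \<in> S)"
      if "u \<in> verts G" "v \<in> verts G" for u v
    proof
      assume uv: "properly_communicate G u v"
      have "{x. properly_communicate G u x} \<in> proper_communication_sets G"
        using that(1) refl[OF uv] by (auto simp: proper_communication_sets_iff)
      then show "\<exists>S\<in>proper_communication_sets G. u \<in> S \<and> v \<in> S"
        using uv refl[OF uv] by blast
    next
      assume "\<exists>S\<in>proper_communication_sets G. u \<in> S \<and> v \<in> S"
      then obtain w where "properly_communicate G w u" "properly_communicate G w v"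
        by (auto simp: proper_communication_sets_iff)
      then show "properly_communicate G u v" by (meson sym trans)
    qed
  qed
  have 2: "P = proper_communication_sets G" if R: "?R P"
  proof -
    have ne: "{} \<notin> P" and sub: "\<And>S x. S \<in> P \<Longrightarrow> x \<in> S \<Longrightarrow> x \<in> verts G"
      and disj: "\<And>S T x. S \<in> P \<Longrightarrow> T \<in> P \<Longrightarrow> x \<in> S \<Longrightarrow> x \<in> T \<Longrightarrow> S = T"
      using R by (auto simp: disjoint_def)
    have iff: "properly_communicate G u v \<longleftrightarrow> (\<exists>S\<in>P. u \<in> S \<and> v \<in> S)"
      if "u \<in> verts G" "v \<in> verts G" for u v
      using R that by simp
    have cls: "S = {v. properly_communicate G u v}" if "S \<in> P" "u \<in> S" for S u
    proof (intro set_eqI iffI CollectI)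
      fix v assume "v \<in> S"
      then show "properly_communicate G u v" using that iff sub by blast
    next
      fix v assume "v \<in> {v. properly_communicate G u v}"
      then have uv: "properly_communicate G u v" by simp
      then obtain T where T: "T \<in> P" "u \<in> T" "v \<in> T" using iff[OF inV[OF uv]] by blast
      then have "T = S" using disj that by blast
      with T show "v \<in> S" by simp
    qed
    show ?thesis
    proof (intro set_eqI iffI)
      fix S assume S: "S \<in> P"
      then obtain u where u: "u \<in> S" using ne by (metis ex_in_conv)
      then have "properly_communicate G u u" using cls[OF S u] by blast
      then show "S \<in> proper_communication_sets G"
        using cls[OF S u] sub[OF S u] by (auto simp: proper_communication_sets_iff)
    next
      fix S assume "S \<in> proper_communication_sets G"
      then obtain u where u: "properly_communicate G u u" "S = {v. properly_communicate G u v}"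
        by (auto simp: proper_communication_sets_iff)
      then obtain T where T: "T \<in> P" "u \<in> T" using iff[OF inV[OF u(1)]] by blast
      then show "S \<in> P" using cls[OF T] u by simp
    qed
  qed
  show ?thesis by (rule iffI) (erule ssubst, rule 1, erule 2)
qed

text \<open>
  An edge from one set to another joins distinct sets, so the proper communication graph has no
  loops. Its arcs are the pairs of vertices that are to be joined, so it has no parallel arcs.
\<close>

definition proper_communication_graph ::
  "('v,'e) pre_digraph \<Rightarrow> ('v set, 'v set \<times> 'v set) pre_digraph" where
  "proper_communication_graph G =
     \<lparr> verts = proper_communication_sets G,
       arcs = {(S, T). S \<in> proper_communication_sets G \<and> T \<in> proper_communication_sets G \<and>
                       S \<noteq> T \<and> (\<exists>u\<in>S. \<exists>v\<in>T. u \<rightarrow>\<^sup>*\<^bsub>G\<^esub> v)},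
       tail = fst, head = snd \<rparr>"

text \<open>
  The definition of the proper communication graph only says between which vertices there is an
  edge. Accordingly, an arbitrary directed graph is compared with it after parallel
  arcs have been merged; for graphs without parallel arcs this changes nothing up to isomorphism.
\<close>

definition merge_parallel :: "('v,'e) pre_digraph \<Rightarrow> ('v, 'v \<times> 'v) pre_digraph" where
  "merge_parallel G = \<lparr> verts = verts G, arcs = arcs_ends G, tail = fst, head = snd \<rparr>"

lemma digraph_iso_merge_parallel:
  assumes "nomulti_digraph G"
  shows "digraph_iso (merge_parallel G) H \<longleftrightarrow> digraph_iso G H"
proof -
  interpret nomulti_digraph G by fact
  let ?f = "\<lparr> iso_verts = id, iso_arcs = arc_to_ends G, iso_head = snd, iso_tail = fst \<rparr>"
  have "digraph_isomorphism ?f"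
    using inj_on_arc_to_ends wf_digraph by (auto simp: digraph_isomorphism_def arc_to_ends_def)
  moreover have "app_iso ?f G = merge_parallel G"
    by (simp add: app_iso_def merge_parallel_def arcs_ends_def)
  ultimately have *: "digraph_iso G (merge_parallel G)"
    unfolding digraph_iso_def by metis
  have "digraph_iso (merge_parallel G) G"
    using * by (rule digraph_iso_swap[OF wf_digraph])
  with * show ?thesis
    by (auto intro: digraph_iso_trans)
qed

section \<open>Shift spaces\<close>

text \<open>
  An alphabet is a finite set \<open>A\<close>. Right rays \<open>x\<^sub>0 x\<^sub>1 \<dots>\<close> are functions on \<open>nat\<close>; a left ray
  \<open>\<dots> x\<^sub>-\<^sub>2 x\<^sub>-\<^sub>1\<close> is encoded by the function \<open>n \<mapsto> x\<^sub>-\<^sub>1\<^sub>-\<^sub>n\<close> on \<open>nat\<close>.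
\<close>

definition full_shift :: "'a set \<Rightarrow> (int \<Rightarrow> 'a) topology" where
  "full_shift A = product_topology (\<lambda>_. discrete_topology A) UNIV"

definition shift_map :: "(int \<Rightarrow> 'a) \<Rightarrow> (int \<Rightarrow> 'a)" where
  "shift_map x = (\<lambda>i. x (i + 1))"

definition shift_space :: "'a set \<Rightarrow> (int \<Rightarrow> 'a) set \<Rightarrow> bool" where
  "shift_space A X \<longleftrightarrow> finite A \<and> closedin (full_shift A) X \<and> shift_map ` X = X"

definition occurs_in :: "'a list \<Rightarrow> (int \<Rightarrow> 'a) \<Rightarrow> bool" where
  "occurs_in w x \<longleftrightarrow> (\<exists>i. \<forall>k<length w. w ! k = x (i + int k))"

definition language :: "(int \<Rightarrow> 'a) set \<Rightarrow> 'a list set" where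
  "language X = {w. \<exists>x\<in>X. occurs_in w x}"

definition shift_of_finite_type :: "'a set \<Rightarrow> (int \<Rightarrow> 'a) set \<Rightarrow> bool" where
  "shift_of_finite_type A X \<longleftrightarrow> shift_space A X \<and>
     (\<exists>F. finite F \<and> X = {x. (\<forall>i. x i \<in> A) \<and> (\<forall>w\<in>F. \<not> occurs_in w x)})"

text \<open>Every finite alphabet is in bijection with a finite set of natural numbers, so it suffices
  to let the shift of finite type be one over such a set.\<close>

definition sofic_shift :: "'a set \<Rightarrow> (int \<Rightarrow> 'a) set \<Rightarrow> bool" where
  "sofic_shift A X \<longleftrightarrow> shift_space A X \<and>
     (\<exists>(B :: nat set) Y \<phi>. shift_of_finite_type B Y \<and>
        continuous_map (subtopology (full_shift B) Y) (full_shift A) \<phi> \<and>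
        (\<forall>y\<in>Y. \<phi> (shift_map y) = shift_map (\<phi> y)) \<and> X = \<phi> ` Y)"

definition irreducible_shift :: "(int \<Rightarrow> 'a) set \<Rightarrow> bool" where
  "irreducible_shift X \<longleftrightarrow>
     (\<forall>u\<in>language X. \<forall>w\<in>language X. \<exists>v\<in>language X. u @ v @ w \<in> language X)"

section \<open>Labelled graphs and the left Fischer cover\<close>

definition labelled_graph :: "'a set \<Rightarrow> ('v,'e) pre_digraph \<Rightarrow> ('e \<Rightarrow> 'a) \<Rightarrow> bool" where
  "labelled_graph A G L \<longleftrightarrow> wf_digraph G \<and> L ` arcs G \<subseteq> A"

definition biinfinite_path :: "('v,'e) pre_digraph \<Rightarrow> (int \<Rightarrow> 'e) \<Rightarrow> bool" where
  "biinfinite_path G p \<longleftrightarrow> (\<forall>i. p i \<in> arcs G \<and> head G (p i) = tail G (p (i + 1)))"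

definition presents ::
  "('v,'e) pre_digraph \<Rightarrow> ('e \<Rightarrow> 'a) \<Rightarrow> (int \<Rightarrow> 'a) set \<Rightarrow> bool" where
  "presents G L X \<longleftrightarrow> X = {\<lambda>i. L (p i) | p. biinfinite_path G p}"

definition left_resolving :: "('v,'e) pre_digraph \<Rightarrow> ('e \<Rightarrow> 'a) \<Rightarrow> bool" where
  "left_resolving G L \<longleftrightarrow>
     (\<forall>e\<in>arcs G. \<forall>f\<in>arcs G. head G e = head G f \<and> L e = L f \<longrightarrow> e = f)"

definition right_closing :: "('v,'e) pre_digraph \<Rightarrow> ('e \<Rightarrow> 'a) \<Rightarrow> bool" where
  "right_closing G L \<longleftrightarrow>
     (\<exists>D. \<forall>u p v q w. pre_digraph.awalk G u p v \<and> pre_digraph.awalk G u q w \<and>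
        length p = D + 1 \<and> length q = D + 1 \<and> map L p = map L q \<longrightarrow> hd p = hd q)"

text \<open>
  A left-resolving graph with finitely many vertices and finitely many labels has finitely many
  edges. Since every finite graph is isomorphic to one whose vertices and edges are natural
  numbers, it suffices to minimize over the latter. Finiteness is explicit because \<open>card\<close> is \<open>0\<close>
  on infinite sets.
\<close>

definition finite_left_resolving_presentation ::
  "'a set \<Rightarrow> (int \<Rightarrow> 'a) set \<Rightarrow> (nat, nat) pre_digraph \<Rightarrow> (nat \<Rightarrow> 'a) \<Rightarrow> bool" where
  "finite_left_resolving_presentation A X G L \<longleftrightarrow>
     fin_digraph G \<and> labelled_graph A G L \<and> presents G L X \<and> left_resolving G L"

definition left_Fischer_cover ::
  "'a set \<Rightarrow> (int \<Rightarrow> 'a) set \<Rightarrow> (nat, nat) pre_digraph \<Rightarrow> (nat \<Rightarrow> 'a) \<Rightarrow> bool" where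
  "left_Fischer_cover A X G L \<longleftrightarrow>
     finite_left_resolving_presentation A X G L \<and>
     (\<forall>H K. finite_left_resolving_presentation A X H K \<longrightarrow> card (verts G) \<le> card (verts H))"

definition AFT_shift :: "'a set \<Rightarrow> (int \<Rightarrow> 'a) set \<Rightarrow> bool" where
  "AFT_shift A X \<longleftrightarrow> sofic_shift A X \<and> irreducible_shift X \<and>
     (\<exists>G L. left_Fischer_cover A X G L \<and> right_closing G L)"

section \<open>The left Krieger cover\<close>

definition right_rays :: "(int \<Rightarrow> 'a) set \<Rightarrow> (nat \<Rightarrow> 'a) set" where
  "right_rays X = {\<lambda>n. x (int n) | x. x \<in> X}"

definition left_rays :: "(int \<Rightarrow> 'a) set \<Rightarrow> (nat \<Rightarrow> 'a) set" where
  "left_rays X = {\<lambda>n. x (- 1 - int n) | x. x \<in> X}"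

definition join_rays :: "(nat \<Rightarrow> 'a) \<Rightarrow> (nat \<Rightarrow> 'a) \<Rightarrow> (int \<Rightarrow> 'a)" where
  "join_rays y x = (\<lambda>i. if i \<ge> 0 then x (nat i) else y (nat (- 1 - i)))"

definition predecessor_set :: "(int \<Rightarrow> 'a) set \<Rightarrow> (nat \<Rightarrow> 'a) \<Rightarrow> (nat \<Rightarrow> 'a) set" where
  "predecessor_set X x = {y \<in> left_rays X. join_rays y x \<in> X}"

text \<open>The ray \<open>a x\<^sup>+\<close> is \<open>case_nat a x\<close>. The edge labelled \<open>a\<close> from \<open>P\<close> to \<open>P'\<close> is the triple
  \<open>(P, a, P')\<close>, so the labelling is \<open>\<lambda>(P, a, P'). a\<close>.\<close>

definition left_Krieger_cover ::
  "(int \<Rightarrow> 'a) set \<Rightarrow>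
     ((nat \<Rightarrow> 'a) set, (nat \<Rightarrow> 'a) set \<times> 'a \<times> (nat \<Rightarrow> 'a) set) pre_digraph" where
  "left_Krieger_cover X =
     \<lparr> verts = predecessor_set X ` right_rays X,
       arcs = {(predecessor_set X (case_nat a x), a, predecessor_set X x) | a x.
                 x \<in> right_rays X \<and> case_nat a x \<in> right_rays X},
       tail = (\<lambda>(P, a, P'). P), head = (\<lambda>(P, a, P'). P') \<rparr>"

end

theory Submission
  imports Defs "HOL-Analysis.Abstract_Topological_Spaces" "HOL-Library.Countable"
begin

text \<open>
  The hypotheses say that \<open>E\<close>, up to parallel arcs, is the strict order of a finite partial order
  \<open>P\<close> with a greatest element \<open>r\<close>, an arc leading from the larger to the smaller element. The shift
  is presented by a graph whose vertices are the points \<open>(u, k)\<close> with \<open>u \<in> P\<close> and \<open>k\<close> a Boolean. It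
  has two kinds of edges. Between any two points there is an edge with a label of its own
  (\<open>Link\<close>). For \<open>u \<ge> v\<close> different from \<open>r\<close>, a pair of edges with one common label leads from
  \<open>(u, k)\<close> to \<open>(v, k)\<close>, one for each \<open>k\<close> (\<open>Step\<close>).

  Every symbol acts on the points as an injective partial map, so the graph is left-resolving and
  right-closing. The links make it irreducible, and they make it the left Fischer cover: in any
  presentation, the constant link sequences at distinct points must pass through distinct
  vertices (\<open>card_V_le\<close>).

  The predecessor set of a right ray depends only on the set of points at which the ray can start
  (\<open>predecessor_set_eq_pasts\<close>), and here it also determines that set (\<open>Pr_inject\<close>). A ray containing
  a link can start at one point only, since the graph is left-resolving. A ray
  consisting of steps never reveals the Boolean, so it can start at both points over some
  \<open>u \<noteq> r\<close>. Hence the vertices of the left Krieger cover are singletons and fibres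
  \<open>{(u, False), (u, True)}\<close> (\<open>starts_cases\<close>). The links connect all singletons with each other and
  to all fibres, while a fibre can only be left along steps (\<open>double_dominatesD\<close>), which move
  down in the order. So the proper communication sets are the set of all singletons, which
  plays the role of \<open>r\<close>, and one set for each \<open>u \<noteq> r\<close>, and paths between them reproduce the order
  (\<open>communication_class_reachable_iff\<close>).
\<close>

section \<open>Bi-infinite paths and pairs of one-sided paths\<close>

definition right_path :: "('v,'e) pre_digraph \<Rightarrow> (nat \<Rightarrow> 'e) \<Rightarrow> bool" where
  "right_path G p \<longleftrightarrow> (\<forall>n. p n \<in> arcs G \<and> head G (p n) = tail G (p (Suc n)))"

text \<open>The edge at index \<open>n\<close> sits at position \<open>- 1 - n\<close>, as for left rays.\<close>

definition left_path :: "('v,'e) pre_digraph \<Rightarrow> (nat \<Rightarrow> 'e) \<Rightarrow> bool" where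
  "left_path G p \<longleftrightarrow> (\<forall>n. p n \<in> arcs G \<and> head G (p (Suc n)) = tail G (p n))"

definition starts :: "('v,'e) pre_digraph \<Rightarrow> ('e \<Rightarrow> 'a) \<Rightarrow> (nat \<Rightarrow> 'a) \<Rightarrow> 'v set" where
  "starts G L x = {tail G (p 0) | p. right_path G p \<and> (\<lambda>n. L (p n)) = x}"

definition pasts :: "('v,'e) pre_digraph \<Rightarrow> ('e \<Rightarrow> 'a) \<Rightarrow> 'v \<Rightarrow> (nat \<Rightarrow> 'a) set" where
  "pasts G L v = {\<lambda>n. L (p n) | p. left_path G p \<and> head G (p 0) = v}"

lemma join_rays_simps [simp]:
  "join_rays y x (int n) = x n"
  "join_rays y x (- 1 - int n) = y n"
  by (simp_all add: join_rays_def)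

lemma join_rays_split: "join_rays (\<lambda>n. z (- 1 - int n)) (\<lambda>n. z (int n)) = z"
  by (rule ext) (simp add: join_rays_def)

lemma join_rays_map: "(\<lambda>i. L (join_rays y x i)) = join_rays (\<lambda>n. L (y n)) (\<lambda>n. L (x n))"
  by (rule ext) (simp add: join_rays_def)

lemma join_rays_inject [simp]: "join_rays y x = join_rays y' x' \<longleftrightarrow> y = y' \<and> x = x'"
proof
  assume eq: "join_rays y x = join_rays y' x'"
  have "y n = y' n \<and> x n = x' n" for n
    using fun_cong[OF eq, of "int n"] fun_cong[OF eq, of "- 1 - int n"] by simp
  then show "y = y' \<and> x = x'" by blast
qed simp

lemma biinfinite_path_join_rays:
  "biinfinite_path G (join_rays q p) \<longleftrightarrow>
    left_path G q \<and> right_path G p \<and> head G (q 0) = tail G (p 0)" (is "?B \<longleftrightarrow> ?R")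
proof
  assume B: ?B
  have 1: "q n \<in> arcs G" "p n \<in> arcs G" for n
    using B[unfolded biinfinite_path_def, rule_format, of "- 1 - int n"]
      B[unfolded biinfinite_path_def, rule_format, of "int n"] by simp_all
  have 2: "head G (p n) = tail G (p (Suc n))" for n
    using B[unfolded biinfinite_path_def, rule_format, of "int n"]
      join_rays_simps(1)[of q p "Suc n"] by (simp add: add.commute)
  have 3: "head G (q (Suc n)) = tail G (q n)" for n
  proof -
    have "- 1 - int (Suc n) + 1 = - 1 - int n" by simp
    then show ?thesis
      using B[unfolded biinfinite_path_def, rule_format, of "- 1 - int (Suc n)"]
      by (metis join_rays_simps(2))
  qed
  have "head G (q 0) = tail G (p 0)"
    using B[unfolded biinfinite_path_def, rule_format, of "- 1"]
      join_rays_simps(1)[of q p 0] join_rays_simps(2)[of q p 0] by simp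
  with 1 2 3 show ?R by (simp add: left_path_def right_path_def)
next
  assume R: ?R
  show ?B unfolding biinfinite_path_def
  proof
    fix i :: int
    consider n where "i = int n" | "i = - 1" | n where "i = - 1 - int (Suc n)"
    proof (cases "i \<ge> - 1")
      case True
      then show ?thesis using that(1)[of "nat i"] that(2) by fastforce
    next
      case False
      then show ?thesis using that(3)[of "nat (- 2 - i)"] by simp
    qed
    then show "join_rays q p i \<in> arcs G \<and> head G (join_rays q p i) = tail G (join_rays q p (i + 1))"
    proof cases
      case 1
      then have "i + 1 = int (Suc n)" by simp
      then show ?thesis using 1 R join_rays_simps(1)[of q p]
        by (metis right_path_def)
    next
      case 2
      then show ?thesis using R join_rays_simps(1)[of q p 0] join_rays_simps(2)[of q p 0]
        by (simp add: left_path_def)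
    next
      case 3
      then have "i + 1 = - 1 - int n" by simp
      then show ?thesis using 3 R join_rays_simps(2)[of q p]
        by (metis left_path_def)
    qed
  qed
qed

lemma biinfinite_path_split:
  assumes "biinfinite_path G p"
  shows "left_path G (\<lambda>n. p (i - 1 - int n))" "right_path G (\<lambda>n. p (i + int n))"
proof -
  have "biinfinite_path G (\<lambda>k. p (k + i))"
    using assms by (simp add: biinfinite_path_def add.commute add.left_commute)
  then have *: "biinfinite_path G
      (join_rays (\<lambda>n. p (- 1 - int n + i)) (\<lambda>n. p (int n + i)))"
    using join_rays_split[of "\<lambda>k. p (k + i)"] by simp
  have "- 1 - int n + i = i - 1 - int n" "int n + i = i + int n" for n by auto
  with *[unfolded biinfinite_path_join_rays] show
    "left_path G (\<lambda>n. p (i - 1 - int n))" "right_path G (\<lambda>n. p (i + int n))" by auto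
qed

lemma right_path_case_nat:
  "right_path G (case_nat e p) \<longleftrightarrow> e \<in> arcs G \<and> head G e = tail G (p 0) \<and> right_path G p"
  by (auto simp: right_path_def split: nat.split)

lemma tail_in_starts: "right_path G p \<Longrightarrow> tail G (p 0) \<in> starts G L (\<lambda>n. L (p n))"
  unfolding starts_def by blast

lemma pasts_head: "left_path G p \<Longrightarrow> (\<lambda>n. L (p n)) \<in> pasts G L (head G (p 0))"
  unfolding pasts_def by blast

lemma join_rays_in_presented:
  assumes "presents G L X"
  shows "join_rays y x \<in> X \<longleftrightarrow> (\<exists>v\<in>starts G L x. y \<in> pasts G L v)"
proof
  assume "join_rays y x \<in> X"
  then obtain p where p: "biinfinite_path G p" "join_rays y x = (\<lambda>i. L (p i))"
    using assms by (auto simp: presents_def)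
  let ?q = "\<lambda>n. p (- 1 - int n)" and ?r = "\<lambda>n. p (int n)"
  have "join_rays y x = join_rays (\<lambda>n. L (?q n)) (\<lambda>n. L (?r n))"
    using join_rays_split[of p] join_rays_map[of L ?q ?r] p(2) by simp
  moreover have "left_path G ?q" "right_path G ?r" "head G (?q 0) = tail G (?r 0)"
    using p(1) join_rays_split[of p] biinfinite_path_join_rays[of G ?q ?r] by auto
  ultimately have "tail G (?r 0) \<in> starts G L x" "y \<in> pasts G L (tail G (?r 0))"
    using tail_in_starts[of G ?r L] pasts_head[of G ?q L] by (metis join_rays_inject)+
  then show "\<exists>v\<in>starts G L x. y \<in> pasts G L v" by blast
next
  assume "\<exists>v\<in>starts G L x. y \<in> pasts G L v"
  then obtain p q where "left_path G q" "right_path G p" "head G (q 0) = tail G (p 0)"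
    and xy: "x = (\<lambda>n. L (p n))" "y = (\<lambda>n. L (q n))"
    by (auto simp: starts_def pasts_def)
  then have "biinfinite_path G (join_rays q p)" by (simp add: biinfinite_path_join_rays)
  then show "join_rays y x \<in> X"
    using assms by (auto simp: presents_def xy join_rays_map[symmetric])
qed

text \<open>This reduces the left Krieger cover to finite combinatorics: a predecessor set depends on the
  ray only through its set of starting vertices, and each step to the left changes
  that set by a rule that depends on the symbol alone (\<open>starts_case_nat\<close>).\<close>

lemma predecessor_set_eq_pasts:
  assumes "presents G L X"
  shows "predecessor_set X x = (\<Union>v\<in>starts G L x. pasts G L v)"
proof -
  have "y \<in> left_rays X" if "join_rays y x \<in> X" for y
  proof -
    have "y = (\<lambda>n. join_rays y x (- 1 - int n))" by simp
    with that show ?thesis unfolding left_rays_def by blast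
  qed
  then show ?thesis
    using join_rays_in_presented[OF assms, of _ x] by (auto simp: predecessor_set_def)
qed

lemma right_rays_iff_pasts:
  assumes "presents G L X"
  shows "x \<in> right_rays X \<longleftrightarrow> (\<exists>v\<in>starts G L x. pasts G L v \<noteq> {})"
proof -
  have "x \<in> right_rays X \<longleftrightarrow> (\<exists>y. join_rays y x \<in> X)"
  proof
    assume "x \<in> right_rays X"
    then obtain z where "z \<in> X" "x = (\<lambda>n. z (int n))" by (auto simp: right_rays_def)
    then show "\<exists>y. join_rays y x \<in> X" using join_rays_split[of z] by metis
  next
    assume "\<exists>y. join_rays y x \<in> X"
    then obtain y where "join_rays y x \<in> X" ..
    moreover have "x = (\<lambda>n. join_rays y x (int n))" by simp
    ultimately show "x \<in> right_rays X" unfolding right_rays_def by blast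
  qed
  then show ?thesis by (auto simp: join_rays_in_presented[OF assms])
qed

lemma starts_case_nat:
  "starts G L (case_nat a x) = {tail G e | e. e \<in> arcs G \<and> L e = a \<and> head G e \<in> starts G L x}"
proof (intro set_eqI iffI)
  fix v assume "v \<in> starts G L (case_nat a x)"
  then obtain p where p: "v = tail G (p 0)" "right_path G p" "(\<lambda>n. L (p n)) = case_nat a x"
    by (auto simp: starts_def)
  have "L (p 0) = a" using fun_cong[OF p(3), of 0] by simp
  moreover have "(\<lambda>n. L (p (Suc n))) = x" using p(3) by (auto simp: fun_eq_iff split: nat.splits)
  moreover have "right_path G (\<lambda>n. p (Suc n))" "p 0 \<in> arcs G" "head G (p 0) = tail G (p (Suc 0))"
    using p(2) by (auto simp: right_path_def)
  ultimately show "v \<in> {tail G e | e. e \<in> arcs G \<and> L e = a \<and> head G e \<in> starts G L x}"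
    using p(1) by (auto simp: starts_def)
next
  fix v assume "v \<in> {tail G e | e. e \<in> arcs G \<and> L e = a \<and> head G e \<in> starts G L x}"
  then obtain e p where "v = tail G e" "e \<in> arcs G" "L e = a" "right_path G p"
    "head G e = tail G (p 0)" "(\<lambda>n. L (p n)) = x"
    by (auto simp: starts_def)
  then have "right_path G (case_nat e p)" "(\<lambda>n. L (case_nat e p n)) = case_nat a x"
    "v = tail G (case_nat e p 0)"
    by (auto simp: right_path_case_nat split: nat.split)
  then show "v \<in> starts G L (case_nat a x)" unfolding starts_def by blast
qed

section \<open>The shift presented by a finite labelled graph\<close>

lemma topspace_full_shift [simp]: "topspace (full_shift A) = {x. \<forall>i. x i \<in> A}"
  by (auto simp: full_shift_def)

lemma continuous_map_coordinate: "continuous_map (full_shift A) (discrete_topology A) (\<lambda>x. x i)"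
  unfolding full_shift_def by (rule continuous_map_product_projection) simp

lemma Hausdorff_full_shift: "Hausdorff_space (full_shift A)"
  unfolding full_shift_def by (simp add: Hausdorff_space_product_topology Hausdorff_space_discrete_topology)

lemma compact_full_shift: "finite A \<Longrightarrow> compact_space (full_shift A)"
  unfolding full_shift_def by (simp add: compact_space_product_topology compact_space_discrete_topology)

lemma closedin_biinfinite_paths: "closedin (full_shift (arcs G)) {p. biinfinite_path G p}"
proof -
  let ?T = "full_shift (arcs G)"
  have cont: "continuous_map ?T (discrete_topology UNIV) (\<lambda>p. f (p i))" for f :: "_ \<Rightarrow> 'b" and i
  proof -
    have "continuous_map (discrete_topology (arcs G)) (discrete_topology UNIV) f" by simp
    from continuous_map_compose[OF continuous_map_coordinate this]
    show ?thesis by (simp add: comp_def)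
  qed
  have "closedin ?T {p \<in> topspace ?T. head G (p i) = tail G (p (i + 1))}" for i
    by (rule closedin_continuous_maps_eq[OF Hausdorff_space_discrete_topology cont cont])
  then have "closedin ?T (\<Inter>i. {p \<in> topspace ?T. head G (p i) = tail G (p (i + 1))})"
    by blast
  also have "(\<Inter>i. {p \<in> topspace ?T. head G (p i) = tail G (p (i + 1))}) = {p. biinfinite_path G p}"
    by (auto simp: biinfinite_path_def)
  finally show ?thesis .
qed

lemma shift_map_biinfinite_paths: "shift_map ` {p. biinfinite_path G p} = {p. biinfinite_path G p}"
proof (intro set_eqI iffI)
  fix p assume "p \<in> shift_map ` {p. biinfinite_path G p}"
  then obtain q where "p = shift_map q" "biinfinite_path G q" by blast
  then show "p \<in> {p. biinfinite_path G p}" by (simp add: biinfinite_path_def shift_map_def)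
next
  fix p assume "p \<in> {p. biinfinite_path G p}"
  then have p: "p i \<in> arcs G" "head G (p i) = tail G (p (i + 1))" for i
    by (auto simp: biinfinite_path_def)
  have "head G (p (i - 1)) = tail G (p i)" for i using p(2)[of "i - 1"] by simp
  then have "biinfinite_path G (\<lambda>i. p (i - 1))"
    using p by (simp add: biinfinite_path_def)
  moreover have "p = shift_map (\<lambda>i. p (i - 1))" by (simp add: shift_map_def)
  ultimately show "p \<in> shift_map ` {p. biinfinite_path G p}" by blast
qed

text \<open>It suffices to forbid the pairs of edges that do not fit together.\<close>

lemma biinfinite_paths_finite_type:
  assumes "finite (arcs G)"
  shows "shift_of_finite_type (arcs G) {p. biinfinite_path G p}"
proof -
  let ?F = "{[e, f] | e f. e \<in> arcs G \<and> f \<in> arcs G \<and> head G e \<noteq> tail G f}"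
  have "?F \<subseteq> (\<lambda>(e, f). [e, f]) ` (arcs G \<times> arcs G)" by auto
  then have "finite ?F" using assms by (meson finite_SigmaI finite_imageI finite_subset)
  moreover have "{p. biinfinite_path G p} = {x. (\<forall>i. x i \<in> arcs G) \<and> (\<forall>w\<in>?F. \<not> occurs_in w x)}"
  proof -
    have occ: "occurs_in [e, f] x \<longleftrightarrow> (\<exists>i. x i = e \<and> x (i + 1) = f)" for e f and x :: "int \<Rightarrow> _"
      unfolding occurs_in_def by (auto simp: less_Suc_eq all_conj_distrib)
    show ?thesis
    proof (intro set_eqI iffI)
      fix x assume "x \<in> {p. biinfinite_path G p}"
      then show "x \<in> {x. (\<forall>i. x i \<in> arcs G) \<and> (\<forall>w\<in>?F. \<not> occurs_in w x)}"
        by (auto simp: biinfinite_path_def occ)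
    next
      fix x assume "x \<in> {x. (\<forall>i. x i \<in> arcs G) \<and> (\<forall>w\<in>?F. \<not> occurs_in w x)}"
      then have x: "x i \<in> arcs G" and F: "w \<in> ?F \<Longrightarrow> \<not> occurs_in w x" for i w by blast+
      have "head G (x i) = tail G (x (i + 1))" for i
      proof (rule ccontr)
        assume "head G (x i) \<noteq> tail G (x (i + 1))"
        then have "[x i, x (i + 1)] \<in> ?F" using x by blast
        then have "\<not> occurs_in [x i, x (i + 1)] x" by (rule F)
        then show False unfolding occ by blast
      qed
      then show "x \<in> {p. biinfinite_path G p}" using x by (simp add: biinfinite_path_def)
    qed
  qed
  ultimately show ?thesis
    unfolding shift_of_finite_type_def shift_space_def
    by (intro conjI exI[of _ ?F] assms closedin_biinfinite_paths shift_map_biinfinite_paths)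
qed

text \<open>The labelling maps the shift of finite type of bi-infinite paths onto the presented
  sequences; these form a closed set because the path space is compact.\<close>

lemma presents_imp_sofic:
  fixes G :: "('v, nat) pre_digraph"
  assumes "finite (arcs G)" "finite A" "L ` arcs G \<subseteq> A" "presents G L X"
  shows "sofic_shift A X"
proof -
  let ?Y = "{p. biinfinite_path G p}" and ?T = "full_shift (arcs G)"
  define \<phi> where "\<phi> p = (\<lambda>i::int. L (p i))" for p
  have X: "X = \<phi> ` ?Y" using assms(4) by (auto simp: presents_def \<phi>_def)
  have cont: "continuous_map ?T (full_shift A) \<phi>"
  proof -
    have "continuous_map ?T (discrete_topology A) (\<lambda>p. L (p i))" for i
    proof -
      have "continuous_map (discrete_topology (arcs G)) (discrete_topology A) L"
        using assms(3) by auto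
      from continuous_map_compose[OF continuous_map_coordinate this]
      show ?thesis by (simp add: comp_def)
    qed
    then show ?thesis
      by (simp add: full_shift_def[of A] continuous_map_componentwise_UNIV \<phi>_def)
  qed
  have "compactin ?T ?Y"
    using closedin_compact_space[OF compact_full_shift[OF assms(1)] closedin_biinfinite_paths] .
  then have "closedin (full_shift A) X"
    unfolding X by (intro compactin_imp_closedin Hausdorff_full_shift image_compactin[OF _ cont])
  moreover have "\<phi> (shift_map p) = shift_map (\<phi> p)" for p
    by (simp add: \<phi>_def shift_map_def)
  then have comm: "\<forall>p\<in>?Y. \<phi> (shift_map p) = shift_map (\<phi> p)" by blast
  have "shift_map ` X = X"
  proof -
    have "shift_map ` X = \<phi> ` shift_map ` ?Y"
      unfolding X image_image using comm by (intro image_cong) auto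
    then show ?thesis by (simp add: shift_map_biinfinite_paths X)
  qed
  ultimately show ?thesis
    unfolding sofic_shift_def shift_space_def
    using assms(2) biinfinite_paths_finite_type[OF assms(1)] comm X
      continuous_map_from_subtopology[OF cont, of ?Y] by blast
qed

lemma presents_imp_irreducible:
  assumes "presents G L X" "wf_digraph G"
    and "\<And>u v. u \<in> verts G \<Longrightarrow> v \<in> verts G \<Longrightarrow> \<exists>e\<in>arcs G. tail G e = u \<and> head G e = v"
  shows "irreducible_shift X"
  unfolding irreducible_shift_def
proof (intro ballI)
  fix u w assume "u \<in> language X" "w \<in> language X"
  then obtain p i q j where p: "biinfinite_path G p" and u: "\<forall>k<length u. u ! k = L (p (i + int k))"
    and q: "biinfinite_path G q" and w: "\<forall>k<length w. w ! k = L (q (j + int k))"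
    using assms(1) by (auto simp: language_def occurs_in_def presents_def)
  define m where "m = i + int (length u)"
  have lp: "left_path G (\<lambda>n. p (m - 1 - int n))" and rq: "right_path G (\<lambda>n. q (j + int n))"
    using biinfinite_path_split[OF p] biinfinite_path_split[OF q] by auto
  have "head G (p (m - 1)) \<in> verts G" "tail G (q j) \<in> verts G"
    using p q assms(2) by (auto simp: biinfinite_path_def wf_digraph_def)
  then obtain e where e: "e \<in> arcs G" "tail G e = head G (p (m - 1))" "head G e = tail G (q j)"
    using assms(3) by metis
  \<comment> \<open>Cut one path behind \<open>u\<close> and the other before \<open>w\<close>, and put the connecting edge at position 0.\<close>
  define r where "r = join_rays (\<lambda>n. p (m - 1 - int n)) (case_nat e (\<lambda>n. q (j + int n)))"
  have "biinfinite_path G r"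
    using lp rq e by (simp add: r_def biinfinite_path_join_rays right_path_case_nat)
  then have inX: "(\<lambda>i. L (r i)) \<in> X" using assms(1) by (auto simp: presents_def)
  have r0: "r 0 = e" by (simp add: r_def join_rays_def)
  have "occurs_in [L e] (\<lambda>i. L (r i))"
    unfolding occurs_in_def by (rule exI[of _ 0]) (simp add: r0)
  moreover have "occurs_in (u @ [L e] @ w) (\<lambda>i. L (r i))"
    unfolding occurs_in_def
  proof (intro exI allI impI)
    fix k assume k: "k < length (u @ [L e] @ w)"
    consider "k < length u" | "k = length u" | l where "k = length u + 1 + l" "l < length w"
    proof (cases "k \<le> length u")
      case False
      then show ?thesis using that(3)[of "k - length u - 1"] k by simp
    qed (use that in linarith)
    then show "(u @ [L e] @ w) ! k = L (r (- int (length u) + int k))"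
    proof cases
      case 1
      have "r (- int (length u) + int k) = p (m - 1 - int (nat (- 1 - (- int (length u) + int k))))"
        using 1 by (simp add: r_def join_rays_def)
      also have "\<dots> = p (i + int k)" using 1 by (simp add: m_def)
      finally show ?thesis using 1 u by (simp add: nth_append)
    next
      case 2
      then show ?thesis by (simp add: r0 nth_append)
    next
      case 3
      then have "- int (length u) + int k = int (Suc l)" by simp
      then have "r (- int (length u) + int k) = q (j + int l)"
        unfolding r_def by (simp only: join_rays_simps nat.case)
      then show ?thesis using 3 w by (simp add: nth_append)
    qed
  qed
  ultimately show "\<exists>v\<in>language X. u @ v @ w \<in> language X"
    using inX unfolding language_def by blast
qed

section \<open>Graph isomorphisms without parallel arcs\<close>

lemma digraph_iso_merge_parallelI:
  assumes "wf_digraph G" "tail H = fst" "head H = snd"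
    and bij: "bij_betw h (verts G) (verts H)" and HV: "arcs H \<subseteq> verts H \<times> verts H"
    and "\<And>u v. u \<in> verts G \<Longrightarrow> v \<in> verts G \<Longrightarrow> u \<rightarrow>\<^bsub>G\<^esub> v \<longleftrightarrow> (h u, h v) \<in> arcs H"
  shows "digraph_iso (merge_parallel G) H"
proof -
  interpret wf_digraph G by fact
  let ?f = "\<lparr> iso_verts = h, iso_arcs = map_prod h h, iso_head = snd, iso_tail = fst \<rparr>"
  have sub: "arcs_ends G \<subseteq> verts G \<times> verts G" by auto
  have inj: "inj_on h (verts G)" and img: "h ` verts G = verts H"
    using bij by (auto simp: bij_betw_def)
  have "wf_digraph (merge_parallel G)"
    using sub by unfold_locales (auto simp: merge_parallel_def)
  moreover have "inj_on (map_prod h h) (arcs_ends G)"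
    using map_prod_inj_on[OF inj inj] sub by (rule inj_on_subset)
  ultimately have "pre_digraph.digraph_isomorphism (merge_parallel G) ?f"
    using inj by (simp add: pre_digraph.digraph_isomorphism_def merge_parallel_def)
  moreover have "arcs H = map_prod h h ` arcs_ends G"
  proof (intro set_eqI iffI)
    fix a assume a: "a \<in> arcs H"
    then obtain u v where "u \<in> verts G" "v \<in> verts G" "a = (h u, h v)"
      using HV img by blast
    then show "a \<in> map_prod h h ` arcs_ends G" using a assms(6) by force
  next
    fix a assume "a \<in> map_prod h h ` arcs_ends G"
    then show "a \<in> arcs H" using assms(6) sub by auto
  qed
  then have "H = app_iso ?f (merge_parallel G)"
    using assms(2,3) img by (simp add: app_iso_def merge_parallel_def)
  ultimately show ?thesis unfolding digraph_iso_def by blast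
qed


section \<open>The labelled graph of a partial order with a greatest element\<close>

text \<open>Points and arrows are coded as natural numbers by \<open>to_nat\<close>, since a left Fischer cover has
  natural numbers as vertices and edges.\<close>

datatype arrow = Link nat nat | Step nat nat bool

instance arrow :: countable by countable_datatype

abbreviation point :: "nat \<Rightarrow> bool \<Rightarrow> nat" where
  "point u k \<equiv> to_nat (u, k)"

primrec source :: "arrow \<Rightarrow> nat" where
  "source (Link f g) = f"
| "source (Step u v k) = point u k"

primrec target :: "arrow \<Rightarrow> nat" where
  "target (Link f g) = g"
| "target (Step u v k) = point v k"

text \<open>The two steps from \<open>u\<close> to \<open>v\<close> share a label, for which the arrow with \<open>False\<close> is taken as the
  representative.\<close>

primrec symbol :: "arrow \<Rightarrow> arrow" where
  "symbol (Link f g) = Link f g"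
| "symbol (Step u v k) = Step u v False"

definition label :: "nat \<Rightarrow> nat" where
  "label e = to_nat (symbol (from_nat e))"

text \<open>\<open>R u v\<close> means that \<open>u\<close> lies above or equals \<open>v\<close>, in the direction of the paths of the
  digraph.\<close>

locale rooted_order =
  fixes P :: "nat set" and r :: nat and R :: "nat \<Rightarrow> nat \<Rightarrow> bool"
  assumes finite_P: "finite P" and root: "r \<in> P"
    and refl: "u \<in> P \<Longrightarrow> R u u"
    and trans: "u \<in> P \<Longrightarrow> v \<in> P \<Longrightarrow> w \<in> P \<Longrightarrow> R u v \<Longrightarrow> R v w \<Longrightarrow> R u w"
    and antisym: "u \<in> P \<Longrightarrow> v \<in> P \<Longrightarrow> R u v \<Longrightarrow> R v u \<Longrightarrow> u = v"
    and greatest: "u \<in> P \<Longrightarrow> R r u"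
begin

definition V :: "nat set" where
  "V = {point u k | u k. u \<in> P}"

text \<open>There are no steps over \<open>r\<close>: its place in the Krieger cover is taken by the singletons, and a
  fibre over \<open>r\<close> would give a further class just below them.\<close>

definition arrows :: "arrow set" where
  "arrows = {Link f g | f g. f \<in> V \<and> g \<in> V} \<union>
     {Step u v k | u v k. u \<in> P - {r} \<and> v \<in> P - {r} \<and> R u v}"

definition G :: "(nat, nat) pre_digraph" where
  "G = \<lparr> verts = V, arcs = to_nat ` arrows,
         tail = \<lambda>e. source (from_nat e), head = \<lambda>e. target (from_nat e) \<rparr>"

definition X :: "(int \<Rightarrow> nat) set" where
  "X = {\<lambda>i. label (p i) | p. biinfinite_path G p}"

abbreviation alphabet :: "nat set" where "alphabet \<equiv> label ` arcs G"

lemma G_simps [simp]: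
  "verts G = V" "arcs G = to_nat ` arrows"
  "tail G (to_nat a) = source a" "head G (to_nat a) = target a"
  by (simp_all add: G_def)

lemma label_to_nat [simp]: "label (to_nat a) = to_nat (symbol a)"
  by (simp add: label_def)

lemma point_in_V [simp]: "point u k \<in> V \<longleftrightarrow> u \<in> P"
  by (auto simp: V_def)

lemma arrows_simps [simp]:
  "Link f g \<in> arrows \<longleftrightarrow> f \<in> V \<and> g \<in> V"
  "Step u v k \<in> arrows \<longleftrightarrow> u \<in> P - {r} \<and> v \<in> P - {r} \<and> R u v"
  by (auto simp: arrows_def)

lemma ends_in_V: "a \<in> arrows \<Longrightarrow> source a \<in> V" "a \<in> arrows \<Longrightarrow> target a \<in> V"
  by (cases a; simp)+

lemma finite_V: "finite V"
proof -
  have "V = to_nat ` (P \<times> (UNIV :: bool set))" unfolding V_def by blast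
  then show ?thesis using finite_P by simp
qed

lemma finite_arrows: "finite arrows"
proof -
  have "arrows \<subseteq> (\<lambda>(f, g). Link f g) ` (V \<times> V) \<union>
      (\<lambda>(u, v, k). Step u v k) ` (P \<times> P \<times> UNIV)"
  proof
    fix a assume "a \<in> arrows"
    then show "a \<in> (\<lambda>(f, g). Link f g) ` (V \<times> V) \<union> (\<lambda>(u, v, k). Step u v k) ` (P \<times> P \<times> UNIV)"
      by (cases a) (auto simp: image_iff)
  qed
  then show ?thesis
    by (rule finite_subset) (use finite_V finite_P in simp)
qed

lemma fin_digraph_G: "fin_digraph G"
  using finite_V finite_arrows ends_in_V by unfold_locales auto

lemma wf_digraph_G: "wf_digraph G"
  using fin_digraph_G by (rule fin_digraph.axioms)

lemma presents_X: "presents G label X"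
  by (simp add: presents_def X_def)

lemma right_path_arrow: "right_path G p \<Longrightarrow> \<exists>a\<in>arrows. p n = to_nat a"
  unfolding right_path_def G_simps by blast

lemma left_path_arrow: "left_path G p \<Longrightarrow> \<exists>a\<in>arrows. p n = to_nat a"
  unfolding left_path_def G_simps by blast

lemma right_path_tail_in_V: "right_path G p \<Longrightarrow> tail G (p n) \<in> V"
  using ends_in_V(1) by (metis right_path_arrow G_simps(3))

lemma starts_in_V: "starts G label x \<subseteq> V"
  using right_path_tail_in_V by (auto simp: starts_def)

lemma symbol_source_inj:
  "symbol a = symbol b \<Longrightarrow> source a = source b \<Longrightarrow> a = b"
  by (cases a; cases b) auto

lemma symbol_target_inj:
  "symbol a = symbol b \<Longrightarrow> target a = target b \<Longrightarrow> a = b"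
  by (cases a; cases b) auto

section \<open>The graph is a right-closing left Fischer cover\<close>

lemma left_resolving_G: "left_resolving G label"
  unfolding left_resolving_def using symbol_target_inj by auto

text \<open>Distinct edges with the same source have distinct labels, so delay \<open>0\<close> suffices.\<close>

lemma right_closing_G: "right_closing G label"
  unfolding right_closing_def
proof (intro exI[of _ 0] allI impI)
  fix u p v q w
  assume *: "pre_digraph.awalk G u p v \<and> pre_digraph.awalk G u q w \<and>
    length p = 0 + 1 \<and> length q = 0 + 1 \<and> map label p = map label q"
  then obtain e f where pq: "p = [e]" "q = [f]"
    by (metis One_nat_def Suc_length_conv add_0 length_0_conv)
  then have "e \<in> arcs G" "f \<in> arcs G" "tail G e = tail G f" "label e = label f"
    using * by (auto simp: pre_digraph.awalk_def pre_digraph.cas.simps)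
  then show "hd p = hd q" using pq symbol_source_inj by auto
qed

lemma link_path: "f \<in> V \<Longrightarrow> left_path G (\<lambda>_. to_nat (Link f f))"
  "f \<in> V \<Longrightarrow> right_path G (\<lambda>_. to_nat (Link f f))"
  by (auto simp: left_path_def right_path_def)

abbreviation link_ray :: "nat \<Rightarrow> nat \<Rightarrow> nat" where
  "link_ray f \<equiv> \<lambda>_. to_nat (Link f f)"

lemma symbol_eq_Link [simp]: "symbol a = Link f g \<longleftrightarrow> a = Link f g"
  by (cases a) auto

lemma link_ray_in_pasts_iff:
  assumes "f \<in> V"
  shows "link_ray f \<in> pasts G label g \<longleftrightarrow> f = g"
proof
  assume "link_ray f \<in> pasts G label g"
  then obtain p where p: "left_path G p" "head G (p 0) = g" "label (p 0) = to_nat (Link f f)"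
    unfolding pasts_def by (auto dest: fun_cong[of _ _ 0])
  then obtain a :: arrow where "p 0 = to_nat a" using left_path_arrow[OF p(1), of 0] by blast
  then show "f = g" using p by auto
next
  assume "f = g"
  then show "link_ray f \<in> pasts G label g"
    using pasts_head[OF link_path(1)[OF assms], of label] by simp
qed

lemma starts_link_ray:
  assumes "f \<in> V"
  shows "starts G label (link_ray f) = {f}"
proof
  show "{f} \<subseteq> starts G label (link_ray f)"
    using tail_in_starts[OF link_path(2)[OF assms], of label] by simp
  show "starts G label (link_ray f) \<subseteq> {f}"
  proof
    fix g assume "g \<in> starts G label (link_ray f)"
    then obtain p where p: "right_path G p" "tail G (p 0) = g" "label (p 0) = to_nat (Link f f)"
      unfolding starts_def by (auto dest: fun_cong[of _ _ 0])
    then obtain a :: arrow where "p 0 = to_nat a" using right_path_arrow[OF p(1), of 0] by blast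
    then show "g \<in> {f}" using p by auto
  qed
qed

text \<open>Any presentation has a path labelled by the constant link at \<open>f\<close>, for each point \<open>f\<close>. If two
  of these met in one vertex, the link at \<open>f\<close> could be followed by the link at \<open>g\<close>, which happens
  only for \<open>f = g\<close>.\<close>

lemma card_V_le:
  assumes H: "fin_digraph H" and pres: "presents H K X"
  shows "card V \<le> card (verts H)"
proof -
  have "\<exists>v. v \<in> starts H K (link_ray f) \<and> link_ray f \<in> pasts H K v" if "f \<in> V" for f
  proof -
    have "join_rays (link_ray f) (link_ray f) \<in> X"
      using that by (auto simp: join_rays_in_presented[OF presents_X]
          starts_link_ray link_ray_in_pasts_iff)
    then show ?thesis by (auto simp: join_rays_in_presented[OF pres])
  qed
  then obtain h where h: "\<And>f. f \<in> V \<Longrightarrow> h f \<in> starts H K (link_ray f)"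
    "\<And>f. f \<in> V \<Longrightarrow> link_ray f \<in> pasts H K (h f)"
    by metis
  have "inj_on h V"
  proof (rule inj_onI)
    fix f g assume fg: "f \<in> V" "g \<in> V" "h f = h g"
    then have "join_rays (link_ray f) (link_ray g) \<in> X"
      using h(1)[of g] h(2)[of f] by (auto simp: join_rays_in_presented[OF pres])
    then show "f = g"
      using fg by (auto simp: join_rays_in_presented[OF presents_X]
          starts_link_ray link_ray_in_pasts_iff)
  qed
  moreover have "h ` V \<subseteq> verts H"
  proof
    fix v assume "v \<in> h ` V"
    then obtain p where "right_path H p" "v = tail H (p 0)"
      using h(1) by (auto simp: starts_def)
    then show "v \<in> verts H"
      using H by (auto simp: right_path_def fin_digraph_def wf_digraph_def)
  qed
  moreover have "finite (verts H)" using H by (rule fin_digraph.finite_verts)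
  ultimately show ?thesis by (rule card_inj_on_le)
qed

lemma left_Fischer_cover_G: "left_Fischer_cover alphabet X G label"
  unfolding left_Fischer_cover_def finite_left_resolving_presentation_def labelled_graph_def
  using fin_digraph_G wf_digraph_G presents_X left_resolving_G card_V_le
  by (metis G_simps(1) order.refl)

lemma AFT_X: "AFT_shift alphabet X"
proof -
  have "sofic_shift alphabet X"
    using presents_X finite_arrows by (intro presents_imp_sofic[of G]) auto
  moreover have "irreducible_shift X"
  proof (rule presents_imp_irreducible[OF presents_X wf_digraph_G])
    fix f g assume "f \<in> verts G" "g \<in> verts G"
    then show "\<exists>e\<in>arcs G. tail G e = f \<and> head G e = g"
      by (intro bexI[of _ "to_nat (Link f g)"]) auto
  qed
  ultimately show ?thesis
    unfolding AFT_shift_def using left_Fischer_cover_G right_closing_G by blast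
qed

section \<open>The left Krieger cover\<close>

definition fibre :: "nat \<Rightarrow> nat set" where
  "fibre u = {point u k | k. True}"

lemma point_in_fibre [simp]: "point u k \<in> fibre v \<longleftrightarrow> u = v"
  by (auto simp: fibre_def)

lemma fibre_subset_V: "u \<in> P \<Longrightarrow> fibre u \<subseteq> V"
  by (auto simp: fibre_def)

lemma fibre_eq_iff [simp]: "fibre u = fibre v \<longleftrightarrow> u = v"
  by (metis point_in_fibre)

lemma fibre_nonempty [simp]: "fibre u \<noteq> {}"
  using point_in_fibre by blast

lemma fibre_neq_singleton [simp]: "fibre u \<noteq> {f}"
proof
  assume "fibre u = {f}"
  then have "point u True = f" "point u False = f" using point_in_fibre by blast+
  then have "point u True = point u False" by simp
  then show False by simp
qed

lemma starts_case_nat_arrow: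
  "starts G label (case_nat a x) =
     {source b | b. b \<in> arrows \<and> to_nat (symbol b) = a \<and> target b \<in> starts G label x}"
proof (rule set_eqI)
  fix f
  have "f \<in> starts G label (case_nat a x) \<longleftrightarrow>
      (\<exists>e\<in>to_nat ` arrows. f = tail G e \<and> label e = a \<and> head G e \<in> starts G label x)"
    unfolding starts_case_nat G_simps by blast
  also have "\<dots> \<longleftrightarrow> (\<exists>b\<in>arrows. f = source b \<and> to_nat (symbol b) = a \<and> target b \<in> starts G label x)"
    by simp
  finally show "f \<in> starts G label (case_nat a x) \<longleftrightarrow>
      f \<in> {source b | b. b \<in> arrows \<and> to_nat (symbol b) = a \<and> target b \<in> starts G label x}"
    by blast
qed

lemma starts_prepend:
  "starts G label (case_nat (to_nat (Link f g)) x) =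
     (if f \<in> V \<and> g \<in> starts G label x then {f} else {})"
  "starts G label (case_nat (to_nat (Step u v False)) x) =
     (if Step u v False \<in> arrows then {point u k | k. point v k \<in> starts G label x} else {})"
proof -
  show "starts G label (case_nat (to_nat (Link f g)) x) =
     (if f \<in> V \<and> g \<in> starts G label x then {f} else {})"
    using starts_in_V by (auto simp: starts_case_nat_arrow)
  have *: "symbol a = Step u v False \<longleftrightarrow> (\<exists>k. a = Step u v k)" for a by (cases a) auto
  show "starts G label (case_nat (to_nat (Step u v False)) x) =
     (if Step u v False \<in> arrows then {point u k | k. point v k \<in> starts G label x} else {})"
    by (auto simp: starts_case_nat_arrow *) force+
qed

text \<open>A path of steps keeps its Boolean, and the Boolean can be flipped along the whole path without
  changing a label.\<close>

lemma starts_of_steps: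
  assumes x: "x = (\<lambda>n. to_nat (Step (u n) (v n) False))" and "starts G label x \<noteq> {}"
  shows "u 0 \<in> P - {r} \<and> starts G label x = fibre (u 0)"
proof -
  obtain p where p: "right_path G p" "(\<lambda>n. label (p n)) = x"
    using assms(2) by (auto simp: starts_def)
  have "\<exists>k. p n = to_nat (Step (u n) (v n) k) \<and> Step (u n) (v n) k \<in> arrows" for n
  proof -
    obtain a where a: "p n = to_nat a" "a \<in> arrows" using p(1) by (auto simp: right_path_def)
    have "label (p n) = to_nat (Step (u n) (v n) False)" using fun_cong[OF p(2), of n] x by simp
    then have "symbol a = Step (u n) (v n) False" using a by simp
    then show ?thesis using a by (cases a) auto
  qed
  then obtain k where k: "\<And>n. p n = to_nat (Step (u n) (v n) (k n))"
    "\<And>n. Step (u n) (v n) (k n) \<in> arrows" by metis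
  have vu: "v n = u (Suc n)" for n
    using p(1) k(1) by (simp add: right_path_def)
  have *: "point (u 0) j \<in> starts G label x" for j
  proof -
    have "right_path G (\<lambda>n. to_nat (Step (u n) (v n) j))"
      using k(2) vu by (auto simp: right_path_def)
    from tail_in_starts[OF this, of label] show ?thesis using x by simp
  qed
  have "starts G label x \<subseteq> fibre (u 0)"
  proof
    fix f assume "f \<in> starts G label x"
    then obtain q where q: "f = tail G (q 0)" "right_path G q" "(\<lambda>n. label (q n)) = x"
      by (auto simp: starts_def)
    obtain a :: arrow where a: "q 0 = to_nat a" using right_path_arrow[OF q(2), of 0] by blast
    have "label (q 0) = to_nat (Step (u 0) (v 0) False)" using fun_cong[OF q(3), of 0] x by simp
    then have "symbol a = Step (u 0) (v 0) False" using a by simp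
    then show "f \<in> fibre (u 0)" using a q(1) by (cases a) auto
  qed
  then show ?thesis using * k(2)[of 0] by (auto simp: fibre_def)
qed

text \<open>The label of a link determines the edge, and from there the left-resolving property
  determines the path back to its start.\<close>

lemma starts_after_link:
  assumes "x n = to_nat (Link f g)" and "starts G label x \<noteq> {}"
  shows "\<exists>h\<in>V. starts G label x = {h}"
proof -
  have "tail G (p 0) = tail G (q 0)"
    if p: "right_path G p" "(\<lambda>n. label (p n)) = x"
      and q: "right_path G q" "(\<lambda>n. label (q n)) = x" for p q
  proof -
    have arr: "p i \<in> arcs G" "q i \<in> arcs G" and lab: "label (p i) = label (q i)" for i
      using p q fun_cong[OF p(2), of i] fun_cong[OF q(2), of i] by (auto simp: right_path_def)
    have "p n = q n"
    proof -
      have "label (p n) = to_nat (Link f g)" "label (q n) = to_nat (Link f g)"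
        using fun_cong[OF p(2), of n] fun_cong[OF q(2), of n] assms(1) by auto
      then show ?thesis using arr(1)[of n] arr(2)[of n] by auto
    qed
    \<comment> \<open>Truncated subtraction makes the descent from \<open>n\<close> stop at position 0.\<close>
    have "p (n - i) = q (n - i)" for i
    proof (induction i)
      case (Suc i)
      show ?case
      proof (cases "n - i")
        case 0
        then show ?thesis using Suc by simp
      next
        case (Suc m)
        then have "head G (p m) = head G (q m)"
          using Suc.IH p(1) q(1) by (simp add: right_path_def)
        then have "p m = q m"
          using left_resolving_G arr lab unfolding left_resolving_def by blast
        moreover have "n - Suc i = m" using Suc by simp
        ultimately show ?thesis by simp
      qed
    qed (simp add: \<open>p n = q n\<close>)
    from this[of n] show ?thesis by simp
  qed
  then have "f = g" if "f \<in> starts G label x" "g \<in> starts G label x" for f g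
    using that by (auto simp: starts_def)
  then show ?thesis using assms(2) starts_in_V[of x] by blast
qed

lemma starts_cases:
  assumes "starts G label x \<noteq> {}"
  obtains f where "f \<in> V" "starts G label x = {f}"
  | u where "u \<in> P - {r}" "starts G label x = fibre u"
proof (cases "\<exists>n f g. x n = to_nat (Link f g)")
  case True
  then show ?thesis using starts_after_link assms that(1) by metis
next
  case False
  have "\<exists>u v. x n = to_nat (Step u v False)" for n
  proof -
    obtain p where "right_path G p" "x = (\<lambda>n. label (p n))" using assms by (auto simp: starts_def)
    then obtain a where "x n = to_nat (symbol a)" using right_path_arrow label_to_nat by metis
    then show ?thesis using False by (cases a) auto
  qed
  then obtain u v where "x = (\<lambda>n. to_nat (Step (u n) (v n) False))" by metis
  from starts_of_steps[OF this assms] show ?thesis using that(2) by blast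
qed

lemma starts_step_ray:
  assumes "u \<in> P - {r}"
  shows "starts G label (\<lambda>_. to_nat (Step u u False)) = fibre u"
proof -
  have "right_path G (\<lambda>_. to_nat (Step u u False))"
    using assms refl by (auto simp: right_path_def)
  from tail_in_starts[OF this, of label]
  have "starts G label (\<lambda>_. to_nat (Step u u False)) \<noteq> {}" by auto
  from starts_of_steps[OF HOL.refl this] show ?thesis by simp
qed

lemma right_rays_iff: "x \<in> right_rays X \<longleftrightarrow> starts G label x \<noteq> {}"
proof -
  have "pasts G label f \<noteq> {}" if "f \<in> V" for f
    using link_ray_in_pasts_iff[OF that] by blast
  then show ?thesis
    using starts_in_V[of x] by (auto simp: right_rays_iff_pasts[OF presents_X])
qed

text \<open>The predecessor set of every right ray whose set of starting points is \<open>T\<close>.\<close>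

definition Pr :: "nat set \<Rightarrow> (nat \<Rightarrow> nat) set" where
  "Pr T = (\<Union>f\<in>T. pasts G label f)"

lemma predecessor_set_X: "predecessor_set X x = Pr (starts G label x)"
  by (simp add: Pr_def predecessor_set_eq_pasts[OF presents_X])

text \<open>The left ray of links at \<open>f\<close> witnesses whether \<open>f\<close> belongs to the set.\<close>

lemma Pr_inject:
  assumes "S \<subseteq> V" "T \<subseteq> V" "Pr S = Pr T"
  shows "S = T"
proof -
  have *: "f \<in> T' \<longleftrightarrow> link_ray f \<in> Pr T'" if "f \<in> V" for f T'
    by (simp add: Pr_def link_ray_in_pasts_iff[OF that])
  have "f \<in> S \<longleftrightarrow> f \<in> T" if "f \<in> V" for f
    using *[OF that, of S] *[OF that, of T] assms(3) by simp
  with assms(1,2) show ?thesis by blast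
qed

abbreviation K where "K \<equiv> left_Krieger_cover X"

abbreviation single :: "nat \<Rightarrow> (nat \<Rightarrow> nat) set" where "single f \<equiv> Pr {f}"
abbreviation double :: "nat \<Rightarrow> (nat \<Rightarrow> nat) set" where "double u \<equiv> Pr (fibre u)"

lemma double_eq_iff: "u \<in> P \<Longrightarrow> v \<in> P \<Longrightarrow> double u = double v \<longleftrightarrow> u = v"
  using Pr_inject[of "fibre u" "fibre v"] fibre_subset_V by auto

lemma single_neq_double: "f \<in> V \<Longrightarrow> u \<in> P \<Longrightarrow> single f \<noteq> double u"
  using Pr_inject[of "{f}" "fibre u"] fibre_subset_V fibre_neq_singleton[of u f] by (auto dest: sym)

lemma verts_K: "verts K = single ` V \<union> double ` (P - {r})"
proof -
  have "right_rays X = {x. starts G label x \<noteq> {}}" using right_rays_iff by blast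
  then have "verts K = Pr ` starts G label ` {x. starts G label x \<noteq> {}}"
    by (simp add: left_Krieger_cover_def predecessor_set_X image_image)
  also have "starts G label ` {x. starts G label x \<noteq> {}} = (\<lambda>f. {f}) ` V \<union> fibre ` (P - {r})"
  proof
    show "starts G label ` {x. starts G label x \<noteq> {}} \<subseteq> (\<lambda>f. {f}) ` V \<union> fibre ` (P - {r})"
      by (auto elim!: starts_cases)
    have "{f} \<in> starts G label ` {x. starts G label x \<noteq> {}}" if "f \<in> V" for f
      by (rule image_eqI[of _ _ "link_ray f"]) (simp_all add: starts_link_ray that)
    moreover have "fibre u \<in> starts G label ` {x. starts G label x \<noteq> {}}" if "u \<in> P - {r}" for u
      by (rule image_eqI[of _ _ "\<lambda>_. to_nat (Step u u False)"]) (simp_all add: starts_step_ray[OF that])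
    ultimately show "(\<lambda>f. {f}) ` V \<union> fibre ` (P - {r}) \<subseteq> starts G label ` {x. starts G label x \<noteq> {}}"
      by blast
  qed
  finally show ?thesis by (simp add: image_Un image_image)
qed

lemma wf_digraph_K: "wf_digraph K"
  by unfold_locales (auto simp: left_Krieger_cover_def)

lemma dominates_K_iff:
  "Z \<rightarrow>\<^bsub>K\<^esub> Z' \<longleftrightarrow> (\<exists>a x. starts G label x \<noteq> {} \<and> starts G label (case_nat a x) \<noteq> {} \<and>
     Z = Pr (starts G label (case_nat a x)) \<and> Z' = Pr (starts G label x))"
proof -
  have "Z \<rightarrow>\<^bsub>K\<^esub> Z' \<longleftrightarrow> (\<exists>e\<in>arcs K. tail K e = Z \<and> head K e = Z')"
    by (auto simp: arcs_ends_def arc_to_ends_def)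
  also have "\<dots> \<longleftrightarrow> (\<exists>a x. x \<in> right_rays X \<and> case_nat a x \<in> right_rays X \<and>
      Z = predecessor_set X (case_nat a x) \<and> Z' = predecessor_set X x)"
    by (auto simp: left_Krieger_cover_def)
  finally show ?thesis by (simp only: predecessor_set_X right_rays_iff)
qed

lemma dominates_KI:
  "starts G label x = S \<Longrightarrow> starts G label (case_nat a x) = T \<Longrightarrow> S \<noteq> {} \<Longrightarrow> T \<noteq> {} \<Longrightarrow> Pr T \<rightarrow>\<^bsub>K\<^esub> Pr S"
  unfolding dominates_K_iff by blast

lemma single_dominates_single: "f \<in> V \<Longrightarrow> g \<in> V \<Longrightarrow> single f \<rightarrow>\<^bsub>K\<^esub> single g"
  by (rule dominates_KI[where x = "link_ray g" and a = "to_nat (Link f g)"])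
    (simp_all add: starts_link_ray starts_prepend)

lemma single_dominates_double: "f \<in> V \<Longrightarrow> u \<in> P - {r} \<Longrightarrow> single f \<rightarrow>\<^bsub>K\<^esub> double u"
  by (rule dominates_KI[where x = "\<lambda>_. to_nat (Step u u False)" and a = "to_nat (Link f (point u True))"])
    (auto simp: starts_step_ray starts_prepend fibre_def)

lemma double_dominates_double:
  "u \<in> P - {r} \<Longrightarrow> v \<in> P - {r} \<Longrightarrow> R u v \<Longrightarrow> double u \<rightarrow>\<^bsub>K\<^esub> double v"
  by (rule dominates_KI[where x = "\<lambda>_. to_nat (Step v v False)" and a = "to_nat (Step u v False)"])
    (auto simp: starts_step_ray starts_prepend fibre_def)

text \<open>Prepending a link leaves at most one starting point, so only a step can lead to a whole
  fibre; and as a step acts injectively, the set it acts on contains a whole fibre as well.\<close>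

lemma double_dominatesD:
  assumes "double u \<rightarrow>\<^bsub>K\<^esub> Z" "u \<in> P - {r}"
  shows "\<exists>v\<in>P - {r}. R u v \<and> Z = double v"
proof -
  obtain a x where x: "starts G label x \<noteq> {}" and Z: "Z = Pr (starts G label x)"
    and "double u = Pr (starts G label (case_nat a x))"
    using assms(1) unfolding dominates_K_iff by blast
  then have u: "starts G label (case_nat a x) = fibre u"
    using Pr_inject[of "fibre u" "starts G label (case_nat a x)"] starts_in_V fibre_subset_V assms(2)
    by auto
  then have "point u True \<in> starts G label (case_nat a x)" by simp
  then obtain b where b: "b \<in> arrows" "to_nat (symbol b) = a"
    by (auto simp: starts_case_nat_arrow)
  show ?thesis
  proof (cases b)
    case (Link f g)
    then have "starts G label (case_nat a x) \<subseteq> {f}"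
      using b by (auto simp: starts_prepend split: if_splits)
    then have "fibre u = {f}" using u point_in_fibre[of u True u] by blast
    then show ?thesis by simp
  next
    case (Step u' v k)
    then have "a = to_nat (Step u' v False)" "Step u' v False \<in> arrows" using b by auto
    then have eq: "fibre u = {point u' k | k. point v k \<in> starts G label x}"
      using u starts_prepend(2)[of u' v x] by simp
    have "u' = u \<and> point v k \<in> starts G label x" for k
    proof -
      have "point u k \<in> {point u' k | k. point v k \<in> starts G label x}"
        using point_in_fibre[of u k u] unfolding eq by simp
      then show ?thesis by auto
    qed
    then have v: "u' = u" "fibre v \<subseteq> starts G label x" by (auto simp: fibre_def)
    from x have "starts G label x = fibre v"
    proof (cases rule: starts_cases)
      case (1 f)
      then have "fibre v = {f}" using v(2) point_in_fibre[of v True v] by (metis empty_iff subset_singletonD)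
      then show ?thesis by simp
    next
      case (2 w)
      then have "v = w" using v(2) point_in_fibre[of v True v] point_in_fibre[of v True w] by blast
      then show ?thesis using 2 by simp
    qed
    then show ?thesis using b(1) Step v(1) Z by auto
  qed
qed

lemma double_reachableD:
  assumes "double u \<rightarrow>\<^sup>*\<^bsub>K\<^esub> Z" "u \<in> P - {r}"
  shows "\<exists>v\<in>P - {r}. R u v \<and> Z = double v"
  using assms(1)
proof (induction rule: wf_digraph.reachable_induct[OF wf_digraph_K, consumes 1])
  case 1
  then show ?case using assms(2) refl by blast
next
  case (2 Y Z)
  then obtain v where v: "v \<in> P - {r}" "R u v" "Y = double v" by blast
  then obtain w where "w \<in> P - {r}" "R v w" "Z = double w" using 2 double_dominatesD by blast
  then show ?case using v assms(2) trans[of u v w] by blast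
qed

section \<open>The proper communication graph\<close>

definition communication_class :: "nat \<Rightarrow> (nat \<Rightarrow> nat) set set" where
  "communication_class u = (if u = r then single ` V else {double u})"

lemma single_communicates:
  assumes "f \<in> V"
  shows "{Z. properly_communicate K (single f) Z} = communication_class r"
proof (intro set_eqI iffI)
  fix Z assume "Z \<in> {Z. properly_communicate K (single f) Z}"
  then have Z: "single f \<rightarrow>\<^sup>+\<^bsub>K\<^esub> Z" "Z \<rightarrow>\<^sup>+\<^bsub>K\<^esub> single f" by (auto simp: properly_communicate_def)
  have "Z \<noteq> double u" if "u \<in> P - {r}" for u
  proof
    assume "Z = double u"
    then have "double u \<rightarrow>\<^sup>*\<^bsub>K\<^esub> single f"
      using Z(2) wf_digraph.reachable1_reachable[OF wf_digraph_K] by blast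
    then show False using double_reachableD that single_neq_double assms by blast
  qed
  moreover have "Z \<in> verts K" using wf_digraph.reachable1_in_verts[OF wf_digraph_K Z(1)] by simp
  ultimately show "Z \<in> communication_class r"
    by (auto simp: communication_class_def verts_K)
next
  fix Z assume "Z \<in> communication_class r"
  then show "Z \<in> {Z. properly_communicate K (single f) Z}"
    using single_dominates_single[OF assms] single_dominates_single[OF _ assms]
    by (auto simp: communication_class_def properly_communicate_def intro!: r_into_trancl)
qed

lemma double_communicates:
  assumes "u \<in> P - {r}"
  shows "{Z. properly_communicate K (double u) Z} = communication_class u"
proof (intro set_eqI iffI)
  fix Z assume "Z \<in> {Z. properly_communicate K (double u) Z}"
  then have Z: "double u \<rightarrow>\<^sup>*\<^bsub>K\<^esub> Z" "Z \<rightarrow>\<^sup>*\<^bsub>K\<^esub> double u"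
    using wf_digraph.reachable1_reachable[OF wf_digraph_K] by (auto simp: properly_communicate_def)
  then obtain v where v: "v \<in> P - {r}" "R u v" "Z = double v"
    using double_reachableD assms by blast
  then obtain w where "w \<in> P - {r}" "R v w" "double u = double w"
    using Z(2) double_reachableD by blast
  then have "v = u" using v assms antisym double_eq_iff by auto
  then show "Z \<in> communication_class u" using v assms by (simp add: communication_class_def)
next
  fix Z assume "Z \<in> communication_class u"
  then show "Z \<in> {Z. properly_communicate K (double u) Z}"
    using assms double_dominates_double[OF assms assms] refl
    by (auto simp: communication_class_def properly_communicate_def)
qed

lemma V_nonempty: "V \<noteq> {}"
  using root point_in_V by blast

lemma proper_communication_sets_K:
  "proper_communication_sets K = communication_class ` P"
proof -
  have self: "properly_communicate K Z Z" if "Z \<in> verts K" for Z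
    using that single_dominates_single double_dominates_double refl
    by (auto simp: verts_K properly_communicate_def)
  have "proper_communication_sets K = (\<lambda>Z. {Z'. properly_communicate K Z Z'}) ` verts K"
    using self by (auto simp: proper_communication_sets_iff)
  also have "\<dots> = (\<lambda>f. communication_class r) ` V \<union> communication_class ` (P - {r})"
    unfolding verts_K image_Un image_image using single_communicates double_communicates
    by (intro arg_cong2[where f = "(\<union>)"] image_cong) auto
  also have "\<dots> = communication_class ` P"
    using V_nonempty root by auto
  finally show ?thesis .
qed

lemma inj_communication_class: "inj_on communication_class P"
proof (rule inj_onI)
  fix u v assume *: "u \<in> P" "v \<in> P" "communication_class u = communication_class v"
  obtain f where f: "f \<in> V" using V_nonempty by blast
  have ne: "single ` V \<noteq> {double w}" if "w \<in> P" for w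
  proof
    assume "single ` V = {double w}"
    then have "single f \<in> {double w}" using f by blast
    then show False using single_neq_double[OF f that] by simp
  qed
  then show "u = v"
    using *(3) ne[OF *(1)] ne[OF *(1), symmetric] ne[OF *(2)] double_eq_iff[OF *(1,2)]
    unfolding communication_class_def by (metis singleton_inject)
qed

lemma communication_class_reachable_iff:
  assumes "u \<in> P" "v \<in> P"
  shows "(\<exists>Y\<in>communication_class u. \<exists>Z\<in>communication_class v. Y \<rightarrow>\<^sup>*\<^bsub>K\<^esub> Z) \<longleftrightarrow> R u v"
proof -
  note step = wf_digraph.reachable_adjI[OF wf_digraph_K]
  obtain f where f: "f \<in> V" using V_nonempty by blast
  consider "u = r" "v = r" | "u = r" "v \<noteq> r" | "u \<noteq> r" "v = r" | "u \<noteq> r" "v \<noteq> r" by blast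
  then show ?thesis
  proof cases
    case 1
    then show ?thesis
      using f step[OF single_dominates_single[OF f f]] refl root by (auto simp: communication_class_def)
  next
    case 2
    then show ?thesis
      using f step[OF single_dominates_double[OF f]] greatest assms by (auto simp: communication_class_def)
  next
    case 3
    have "\<not> double u \<rightarrow>\<^sup>*\<^bsub>K\<^esub> single g" if "g \<in> V" for g
      using 3 assms that double_reachableD single_neq_double by blast
    moreover have "\<not> R u v" using 3 assms antisym greatest by blast
    ultimately show ?thesis using 3 by (auto simp: communication_class_def)
  next
    case 4
    have "double u \<rightarrow>\<^sup>*\<^bsub>K\<^esub> double v \<longleftrightarrow> R u v"
    proof
      assume "double u \<rightarrow>\<^sup>*\<^bsub>K\<^esub> double v"
      then show "R u v" using 4 assms double_reachableD[of u "double v"] double_eq_iff by auto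
    next
      assume "R u v"
      then show "double u \<rightarrow>\<^sup>*\<^bsub>K\<^esub> double v" using 4 assms step double_dominates_double by blast
    qed
    then show ?thesis using 4 by (simp add: communication_class_def)
  qed
qed

end

theorem proposition5p1:
  fixes E :: "('v, 'e) pre_digraph"
  assumes "fin_digraph E"
    and "has_root E"
    and "\<not> has_circuit E"
    and "\<And>u v. u \<in> verts E \<Longrightarrow> v \<in> verts E \<Longrightarrow> strictly_above E u v \<Longrightarrow> u \<rightarrow>\<^bsub>E\<^esub> v"
  shows "\<exists>(A :: nat set) X. AFT_shift A X \<and>
    digraph_iso (merge_parallel E) (proper_communication_graph (left_Krieger_cover X))"
proof -
  interpret E: fin_digraph E by fact
  obtain t where t: "t \<in> verts E" "\<And>v. v \<in> verts E \<Longrightarrow> t \<rightarrow>\<^sup>*\<^bsub>E\<^esub> v"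
    using assms(2) by (auto simp: has_root_def maximal_vertex_def)
  have acyclic: "\<not> u \<rightarrow>\<^sup>+\<^bsub>E\<^esub> u" for u
    using assms(3) by (auto simp: has_circuit_def E.reachable1_awalk)
  have antisym: "u = v" if "u \<rightarrow>\<^sup>*\<^bsub>E\<^esub> v" "v \<rightarrow>\<^sup>*\<^bsub>E\<^esub> u" for u v
    using that acyclic E.reachable_neq_reachable1 E.reachable1_reachable_trans by metis
  \<comment> \<open>Without circuits, the last hypothesis makes the arcs exactly the strict order.\<close>
  have arc_iff: "u \<rightarrow>\<^bsub>E\<^esub> v \<longleftrightarrow> u \<noteq> v \<and> u \<rightarrow>\<^sup>*\<^bsub>E\<^esub> v" if "u \<in> verts E" "v \<in> verts E" for u v
    using that assms(4) antisym acyclic unfolding strictly_above_def by blast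
  obtain \<iota> :: "'v \<Rightarrow> nat" where \<iota>: "inj_on \<iota> (verts E)"
    using finite_imp_inj_to_nat_seg[OF E.finite_verts] by blast
  define R where "R a b \<longleftrightarrow> (\<exists>u\<in>verts E. \<exists>v\<in>verts E. a = \<iota> u \<and> b = \<iota> v \<and> u \<rightarrow>\<^sup>*\<^bsub>E\<^esub> v)" for a b
  have R: "R (\<iota> u) (\<iota> v) \<longleftrightarrow> u \<rightarrow>\<^sup>*\<^bsub>E\<^esub> v" if "u \<in> verts E" "v \<in> verts E" for u v
    using that \<iota> by (auto simp: R_def inj_on_eq_iff)
  interpret O: rooted_order "\<iota> ` verts E" "\<iota> t" R
  proof
    show "finite (\<iota> ` verts E)" "\<iota> t \<in> \<iota> ` verts E" using t by auto
    show "R a a" if "a \<in> \<iota> ` verts E" for a using that R by auto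
    show "R a c" if "a \<in> \<iota> ` verts E" "b \<in> \<iota> ` verts E" "c \<in> \<iota> ` verts E" "R a b" "R b c" for a b c
      using that R E.reachable_trans by auto
    show "a = b" if "a \<in> \<iota> ` verts E" "b \<in> \<iota> ` verts E" "R a b" "R b a" for a b
      using that R antisym by (auto dest!: antisym)
    show "R (\<iota> t) a" if "a \<in> \<iota> ` verts E" for a using that R t by auto
  qed
  let ?H = "proper_communication_graph (left_Krieger_cover O.X)"
  let ?h = "\<lambda>u. O.communication_class (\<iota> u)"
  have "digraph_iso (merge_parallel E) ?H"
  proof (rule digraph_iso_merge_parallelI[OF E.wf_digraph_axioms])
    show "tail ?H = fst" "head ?H = snd" "arcs ?H \<subseteq> verts ?H \<times> verts ?H"
      by (auto simp: proper_communication_graph_def)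
    show "bij_betw ?h (verts E) (verts ?H)"
      using comp_inj_on[OF \<iota> O.inj_communication_class]
      by (simp add: bij_betw_def proper_communication_graph_def O.proper_communication_sets_K
          comp_def image_image)
    show "u \<rightarrow>\<^bsub>E\<^esub> v \<longleftrightarrow> (?h u, ?h v) \<in> arcs ?H" if uv: "u \<in> verts E" "v \<in> verts E" for u v
    proof -
      have "?h u = ?h v \<longleftrightarrow> u = v"
        using uv \<iota> O.inj_communication_class by (auto simp: inj_on_eq_iff)
      then show ?thesis
        using uv O.communication_class_reachable_iff[of "\<iota> u" "\<iota> v"] R[OF uv] arc_iff[OF uv]
        by (simp add: proper_communication_graph_def O.proper_communication_sets_K)
    qed
  qed
  then show ?thesis using O.AFT_X by blast
qed

end
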